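(* A multimeasure $N:\Sigma\to c(X)$ has a finite control measure if and only if it satisfies the countable chain condition. Moreover, in this case there exists a control measure $\mu$ equivalent to $N$, i.e. a finite nonnegative measure $\mu$ on $\Sigma$ such that for $E\in\Sigma$: $\mu(E)=0$ if and only if $N(F)=\{0\}$ for every $F\in\Sigma$ with $F\subseteq E$.
   Context: $(\Omega,\Sigma)$ is a measurable space and $X$ is a Hausdorff locally convex space with dual $X'$. $c(X)$ is the family of nonempty closed convex subsets of $X$; $s(x',C)=\sup\{\langle x',x\rangle:x\in C\}$. A multimeasure is a map $N:\Sigma\to c(X)$ such that for every $x'\in X'$ the set function $s(x',N(\cdot))$ is a $\sigma$-finite countably additive measure with values in $(-\infty,+\infty]$. $\mathcal N(N)=\{E\in\Sigma:N(E)=\{0\}\}$. A control measure for $N$ is a finite nonnegative measure $\mu$ on $\Sigma$ such that $\mu(E)=0$ implies $N(E)=\{0\}$. $N$ satisfies the countable chain condition if every family of pairwise disjoint sets in $\Sigma\setminus\mathcal N(N)$ is at most countable. *)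

theory Defs
  imports "HOL-Analysis.Analysis"
begin

definition locally_convex_tvs :: "'x::{real_vector, t2_space} itself \<Rightarrow> bool" where
  "locally_convex_tvs _ \<longleftrightarrow>
     continuous_on UNIV (\<lambda>p::'x \<times> 'x. fst p + snd p) \<and>
     continuous_on UNIV (\<lambda>p::real \<times> 'x. fst p *\<^sub>R snd p) \<and>
     (\<forall>U::'x set. open U \<and> 0 \<in> U \<longrightarrow> (\<exists>V. open V \<and> convex V \<and> 0 \<in> V \<and> V \<subseteq> U))"

definition topdual :: "('x::{real_vector, topological_space} \<Rightarrow> real) set" where
  "topdual = {f. linear f \<and> continuous_on UNIV f}"

definition cX :: "'x::{real_vector, topological_space} set set" where
  "cX = {C. C \<noteq> {} \<and> closed C \<and> convex C}"

definition supp_fun :: "('x \<Rightarrow> real) \<Rightarrow> 'x set \<Rightarrow> ereal" where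
  "supp_fun f C = (SUP x\<in>C. ereal (f x))"

definition sigma_finite_ext_measure :: "'w measure \<Rightarrow> ('w set \<Rightarrow> ereal) \<Rightarrow> bool" where
  "sigma_finite_ext_measure M g \<longleftrightarrow>
     (\<forall>E\<in>sets M. g E \<noteq> -\<infinity>) \<and>
     g {} = 0 \<and>
     (\<forall>A::nat \<Rightarrow> 'w set. range A \<subseteq> sets M \<longrightarrow> disjoint_family A \<longrightarrow>
         (\<lambda>n. g (A n)) sums g (\<Union>n. A n)) \<and>
     (\<exists>A::nat \<Rightarrow> 'w set. range A \<subseteq> sets M \<and> (\<Union>n. A n) = space M \<and> (\<forall>n. \<bar>g (A n)\<bar> \<noteq> \<infinity>))"

definition multimeasure :: "'w measure \<Rightarrow> ('w set \<Rightarrow> 'x::{real_vector, topological_space} set) \<Rightarrow> bool" where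
  "multimeasure M N \<longleftrightarrow>
     (\<forall>E\<in>sets M. N E \<in> cX) \<and>
     (\<forall>f\<in>topdual. sigma_finite_ext_measure M (\<lambda>E. supp_fun f (N E)))"

definition null_sets_mm :: "'w measure \<Rightarrow> ('w set \<Rightarrow> 'x::real_vector set) \<Rightarrow> 'w set set" where
  "null_sets_mm M N = {E \<in> sets M. N E = {0}}"

definition control_measure :: "'w measure \<Rightarrow> ('w set \<Rightarrow> 'x::real_vector set) \<Rightarrow> 'w measure \<Rightarrow> bool" where
  "control_measure M N \<mu> \<longleftrightarrow>
     space \<mu> = space M \<and> sets \<mu> = sets M \<and> finite_measure \<mu> \<and>
     (\<forall>E\<in>sets M. emeasure \<mu> E = 0 \<longrightarrow> N E = {0})"

definition ccc_mm :: "'w measure \<Rightarrow> ('w set \<Rightarrow> 'x::real_vector set) \<Rightarrow> bool" where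
  "ccc_mm M N \<longleftrightarrow>
     (\<forall>F. F \<subseteq> sets M - null_sets_mm M N \<longrightarrow> disjoint F \<longrightarrow> countable F)"

end

theory Submission
  imports Defs
begin

text \<open>Continuous functionals separate points, so \<open>N E = {0}\<close> iff all \<open>s(x', N E)\<close> vanish, and every set
  that is not hereditarily null contains some \<open>F\<close> with \<open>0 < s(x', N F) < \<infinity>\<close> for some \<open>x'\<close>.
  By the chain condition, a maximal disjoint family of subsets of \<open>F\<close> with a given property is
  countable. Removing in this way from \<open>F\<close> first the sets of negative \<open>x'\<close>-measure and then the
  \<open>x'\<close>-null sets that are not hereditarily \<open>N\<close>-null leaves a set \<open>S\<close> on which \<open>s(x', N(\<cdot>))\<close> is a finite
  nonnegative measure with exactly the \<open>N\<close>-null sets. A maximal disjoint family of such sets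
  \<open>S\<close> is countable and exhausts the space, and a weighted sum of the corresponding measures is the
  required one.\<close>

section \<open>Separation of points in locally convex spaces\<close>

definition sublinear :: "('x::real_vector \<Rightarrow> real) \<Rightarrow> bool" where
  "sublinear q \<longleftrightarrow> (\<forall>x y. q (x + y) \<le> q x + q y) \<and> (\<forall>c x. 0 < c \<longrightarrow> q (c *\<^sub>R x) = c * q x)"

lemma sublinear_add: "sublinear q \<Longrightarrow> q (x + y) \<le> q x + q y"
  and sublinear_scale: "sublinear q \<Longrightarrow> 0 < c \<Longrightarrow> q (c *\<^sub>R x) = c * q x"
  by (auto simp: sublinear_def)

lemma sublinear_zero:
  assumes "sublinear q"
  shows "q 0 = 0"
  using sublinear_scale[OF assms, of 2 0] by simp

text \<open>The reverse inequality comes from applying \<open>scale\<close> with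
  \<open>inverse c\<close> at \<open>c *\<^sub>R x\<close>. The infima built below yield only the
  upper bound directly.\<close>

lemma sublinearI:
  assumes add: "\<And>x y. q (x + y) \<le> q x + q y"
    and scale: "\<And>c x. 0 < c \<Longrightarrow> q (c *\<^sub>R x) \<le> c * q x"
  shows "sublinear q"
  unfolding sublinear_def
proof (intro conjI allI impI add antisym scale)
  fix c :: real and x assume c: "0 < c"
  have "q x \<le> inverse c * q (c *\<^sub>R x)"
    using scale[of "inverse c" "c *\<^sub>R x"] c by simp
  then show "c * q x \<le> q (c *\<^sub>R x)"
    using c by (simp add: field_simps)
qed

lemma sublinear_lower:
  assumes "sublinear q"
  shows "- q (- x) \<le> q x"
  using sublinear_add[OF assms, of x "- x"] sublinear_zero[OF assms] by simp

text \<open>The largest sublinear functional below \<open>q\<close> whose value at \<open>- y\<close> is at most \<open>- q y\<close>.\<close>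

definition shave :: "('x::real_vector \<Rightarrow> real) \<Rightarrow> 'x \<Rightarrow> 'x \<Rightarrow> real" where
  "shave q y z = (INF t\<in>{0..}. q (z + t *\<^sub>R y) - t * q y)"

text \<open>Real infima carry information only over sets bounded below. Writing
  \<open>t *\<^sub>R y\<close> as \<open>(z + t *\<^sub>R y) + (- z)\<close> gives the bound
  \<open>- q (- z)\<close>, uniformly in \<open>t\<close>.\<close>

lemma shave_bdd_below:
  assumes q: "sublinear q"
  shows "bdd_below ((\<lambda>t. q (z + t *\<^sub>R y) - t * q y) ` {0..})"
proof (rule bdd_belowI2)
  fix t :: real assume t: "t \<in> {0..}"
  have "q (t *\<^sub>R y) = t * q y"
    using t sublinear_scale[OF q, of t y] sublinear_zero[OF q] by (cases "t = 0") auto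
  moreover have "q (t *\<^sub>R y) \<le> q (z + t *\<^sub>R y) + q (- z)"
    using sublinear_add[OF q, of "z + t *\<^sub>R y" "- z"] by simp
  ultimately show "- q (- z) \<le> q (z + t *\<^sub>R y) - t * q y" by simp
qed

lemma shave_le:
  assumes "sublinear q" "0 \<le> t"
  shows "shave q y z \<le> q (z + t *\<^sub>R y) - t * q y"
  unfolding shave_def using assms by (intro cINF_lower shave_bdd_below) auto

text \<open>Shifts \<open>s\<close> for \<open>a\<close> and \<open>t\<close> for \<open>b\<close>
  combine to the shift \<open>s + t\<close> for \<open>a + b\<close>, and a shift \<open>t\<close>
  for \<open>a\<close> becomes \<open>c * t\<close> for \<open>c *\<^sub>R a\<close>.\<close>

lemma shave_sublinear:
  assumes q: "sublinear q"
  shows "sublinear (shave q y)"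
proof (rule sublinearI)
  fix a b
  have step: "shave q y (a + b) \<le> (q (a + s *\<^sub>R y) - s * q y) + (q (b + t *\<^sub>R y) - t * q y)"
    if "0 \<le> s" "0 \<le> t" for s t
  proof -
    have "shave q y (a + b) \<le> q ((a + b) + (s + t) *\<^sub>R y) - (s + t) * q y"
      using that by (intro shave_le q) auto
    also have "(a + b) + (s + t) *\<^sub>R y = (a + s *\<^sub>R y) + (b + t *\<^sub>R y)"
      by (simp add: algebra_simps)
    finally show ?thesis
      using sublinear_add[OF q, of "a + s *\<^sub>R y" "b + t *\<^sub>R y"] by (simp add: algebra_simps)
  qed
  \<comment> \<open>The infima are taken one variable at a time: first over the shift of
    \<open>b\<close>, then over that of \<open>a\<close>.\<close>
  have "shave q y (a + b) - (q (a + s *\<^sub>R y) - s * q y) \<le> shave q y b" if "0 \<le> s" for s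
    unfolding shave_def[of q y b]
    by (rule cINF_greatest) (use step[OF that] in \<open>auto simp: algebra_simps\<close>)
  then have "shave q y (a + b) - shave q y b \<le> q (a + s *\<^sub>R y) - s * q y" if "0 \<le> s" for s
    using that by (smt (verit))
  then have "shave q y (a + b) - shave q y b \<le> shave q y a"
    unfolding shave_def[of q y a] by (intro cINF_greatest) auto
  then show "shave q y (a + b) \<le> shave q y a + shave q y b" by simp
next
  fix c :: real and a assume c: "0 < c"
  have "shave q y (c *\<^sub>R a) / c \<le> q (a + t *\<^sub>R y) - t * q y" if "0 \<le> t" for t
  proof -
    have "shave q y (c *\<^sub>R a) \<le> q (c *\<^sub>R a + (c * t) *\<^sub>R y) - (c * t) * q y"
      using c that by (intro shave_le q) auto
    also have "c *\<^sub>R a + (c * t) *\<^sub>R y = c *\<^sub>R (a + t *\<^sub>R y)"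
      by (simp add: algebra_simps)
    also have "q \<dots> = c * q (a + t *\<^sub>R y)"
      by (rule sublinear_scale[OF q c])
    finally show ?thesis using c by (simp add: field_simps)
  qed
  then have "shave q y (c *\<^sub>R a) / c \<le> shave q y a"
    unfolding shave_def[of q y a] by (intro cINF_greatest) auto
  then show "shave q y (c *\<^sub>R a) \<le> c * shave q y a"
    using c by (simp add: field_simps)
qed

text \<open>Supplies the bounds of chains for Zorn's lemma. The common majorant \<open>p\<close>
  keeps the pointwise infimum finite through \<open>- p (- x)\<close>; for subadditivity, two
  members of the chain are replaced by the smaller one.\<close>

lemma sublinear_chain_INF:
  fixes C :: "('x::real_vector \<Rightarrow> real) set"
  assumes ne: "C \<noteq> {}" and sub: "\<And>q. q \<in> C \<Longrightarrow> sublinear q"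
    and chain: "\<And>q r. q \<in> C \<Longrightarrow> r \<in> C \<Longrightarrow> q \<le> r \<or> r \<le> q"
    and le: "\<And>q. q \<in> C \<Longrightarrow> q \<le> p"
  shows "sublinear (\<lambda>x. INF q\<in>C. q x)" "\<And>q. q \<in> C \<Longrightarrow> (\<lambda>x. INF q\<in>C. q x) \<le> q"
proof -
  have bdd: "bdd_below ((\<lambda>q. q x) ` C)" for x
  proof (rule bdd_belowI2)
    fix q assume "q \<in> C"
    then show "- p (- x) \<le> q x"
      using sublinear_lower[OF sub, of q x] le[of q] by (auto simp: le_fun_def) (smt (verit))
  qed
  show low: "(\<lambda>x. INF q\<in>C. q x) \<le> q" if "q \<in> C" for q
    using that by (intro le_funI cINF_lower bdd)
  show "sublinear (\<lambda>x. INF q\<in>C. q x)"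
  proof (rule sublinearI)
    fix a b
    let ?r = "\<lambda>x. INF q\<in>C. q x"
    have step: "?r (a + b) \<le> q a + r b" if qr: "q \<in> C" "r \<in> C" for q r
    proof -
      obtain s where s: "s \<in> C" "s \<le> q" "s \<le> r"
        using chain[OF qr] qr by blast
      have "?r (a + b) \<le> s (a + b)" using low[OF s(1)] by (auto simp: le_fun_def)
      also have "\<dots> \<le> s a + s b" by (rule sublinear_add[OF sub[OF s(1)]])
      also have "\<dots> \<le> q a + r b" using s by (intro add_mono) (auto simp: le_fun_def)
      finally show ?thesis .
    qed
    have "?r (a + b) - q a \<le> ?r b" if "q \<in> C" for q
      using step[OF that] ne by (intro cINF_greatest) (auto simp: algebra_simps)
    then have "?r (a + b) - ?r b \<le> q a" if "q \<in> C" for q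
      using that by (smt (verit))
    then have "?r (a + b) - ?r b \<le> ?r a"
      using ne by (intro cINF_greatest) auto
    then show "?r (a + b) \<le> ?r a + ?r b" by simp
  next
    fix c :: real and a assume c: "0 < c"
    let ?r = "\<lambda>x. INF q\<in>C. q x"
    have "?r (c *\<^sub>R a) / c \<le> ?r a"
    proof (rule cINF_greatest[OF ne])
      fix q assume q: "q \<in> C"
      have "?r (c *\<^sub>R a) \<le> q (c *\<^sub>R a)" using low[OF q] by (auto simp: le_fun_def)
      then show "?r (c *\<^sub>R a) / c \<le> q a"
        using c sublinear_scale[OF sub[OF q] c] by (simp add: field_simps)
    qed
    then show "?r (c *\<^sub>R a) \<le> c * ?r a" using c by (simp add: field_simps)
  qed
qed

text \<open>A minimal sublinear functional \<open>q\<close> is linear: \<open>shave q y \<le> q\<close> is again sublinear, so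
  minimality gives \<open>q z \<le> q (z + y) - q y\<close>.\<close>

lemma linear_below_sublinear:
  fixes p :: "'x::real_vector \<Rightarrow> real"
  assumes p: "sublinear p"
  obtains f where "linear f" "f \<le> p"
proof -
  let ?S = "{q. sublinear q \<and> q \<le> p}"
  have "\<exists>m\<in>?S. \<forall>a\<in>?S. a \<le> m \<longrightarrow> a = m"
  \<comment> \<open>The order is reversed, so that Zorn's maximal element is a minimal sublinear
    functional below \<open>p\<close>.\<close>
  proof (rule predicate_Zorn[where P = "\<lambda>a b. b \<le> a"])
    show "partial_order_on ?S (relation_of (\<lambda>a b. b \<le> a) ?S)"
      by (rule partial_order_on_relation_ofI) auto
  next
    fix C assume C: "C \<in> Chains (relation_of (\<lambda>a b. b \<le> a) ?S)"
    show "\<exists>u\<in>?S. \<forall>a\<in>C. u \<le> a"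
    proof (cases "C = {}")
      case True
      then show ?thesis using p by auto
    next
      case False
      have CS: "sublinear q" "q \<le> p" if "q \<in> C" for q
        using C that by (auto simp: Chains_def relation_of_def)
      have ch: "q \<le> r \<or> r \<le> q" if "q \<in> C" "r \<in> C" for q r
        using C that by (auto simp: Chains_def relation_of_def)
      note INF = sublinear_chain_INF[OF False CS(1) ch CS(2)]
      obtain q where "q \<in> C" using False by auto
      then have "(\<lambda>x. INF q\<in>C. q x) \<le> p"
        using INF(2) CS(2) order_trans by blast
      then show ?thesis using INF by blast
    qed
  qed
  then obtain q where q: "sublinear q" "q \<le> p"
    and min: "\<And>a. sublinear a \<Longrightarrow> a \<le> p \<Longrightarrow> a \<le> q \<Longrightarrow> a = q"
    by auto
  have add: "q (z + y) = q z + q y" for z y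
  proof (rule antisym[OF sublinear_add[OF q(1)]])
    have le: "shave q y \<le> q"
      using shave_le[OF q(1), of 0 y] by (auto simp: le_fun_def)
    then have "shave q y = q"
      using q by (intro min shave_sublinear) auto
    then show "q z + q y \<le> q (z + y)"
      using shave_le[OF q(1), of 1 y z] by simp
  qed
  have neg: "q (- x) = - q x" for x
    using add[of x "- x"] sublinear_zero[OF q(1)] by simp
  have "q (c *\<^sub>R x) = c * q x" for c x
  proof (cases c "0 :: real" rule: linorder_cases)
    case less
    then show ?thesis
      using sublinear_scale[OF q(1), of "- c" x] neg[of "c *\<^sub>R x"] by simp
  qed (use sublinear_zero sublinear_scale q in auto)
  then have "linear q" using add by (intro linearI) auto
  then show ?thesis using q that by blast
qed

text \<open>A linear \<open>f\<close> below \<open>shave p x\<close> lies below \<open>p\<close>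
  (shift 0) and satisfies \<open>f (- x) \<le> - p x\<close> (shift 1, where the argument of
  \<open>p\<close> becomes 0), that is, \<open>p x \<le> f x\<close>.\<close>

lemma linear_below_sublinear_at:
  fixes p :: "'x::real_vector \<Rightarrow> real"
  assumes p: "sublinear p"
  obtains f where "linear f" "f \<le> p" "f x = p x"
proof -
  obtain f where f: "linear f" "f \<le> shave p x"
    using linear_below_sublinear[OF shave_sublinear[OF p]] by blast
  have "f \<le> p"
    using f(2) shave_le[OF p, of 0 x] by (auto simp: le_fun_def intro: order_trans)
  moreover have "f (- x) \<le> - p x"
    using f(2) shave_le[OF p, of 1 x "- x"] sublinear_zero[OF p]
    by (auto simp: le_fun_def intro: order_trans)
  ultimately show ?thesis
    using f(1) that[of f] by (force simp: le_fun_def linear_neg intro: antisym)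
qed

section \<open>The Minkowski gauge and the separating functional\<close>

definition gauge_fun :: "'x::real_vector set \<Rightarrow> 'x \<Rightarrow> real" where
  "gauge_fun V y = Inf {t. 0 < t \<and> inverse t *\<^sub>R y \<in> V}"

lemma gauge_fun_le:
  assumes "0 < t" "inverse t *\<^sub>R y \<in> V"
  shows "gauge_fun V y \<le> t"
  unfolding gauge_fun_def using assms
  by (intro cInf_lower) (auto intro!: bdd_belowI[of _ 0])

text \<open>Convexity gives subadditivity; absorption makes every set under the infimum
  non-empty.\<close>

lemma sublinear_gauge_fun:
  assumes V: "convex V" and absorb: "\<And>y. \<exists>t>0. inverse t *\<^sub>R y \<in> V"
  shows "sublinear (gauge_fun V)"
proof (rule sublinearI)
  fix a b
  have step: "gauge_fun V (a + b) \<le> s + t"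
    if s: "0 < s" "inverse s *\<^sub>R a \<in> V" and t: "0 < t" "inverse t *\<^sub>R b \<in> V" for s t
  proof (rule gauge_fun_le)
    \<comment> \<open>These weights make the convex combination collapse to
      \<open>inverse (s + t) *\<^sub>R (a + b)\<close>.\<close>
    have "(s / (s + t)) *\<^sub>R (inverse s *\<^sub>R a) + (t / (s + t)) *\<^sub>R (inverse t *\<^sub>R b) \<in> V"
      using s t by (intro convexD[OF V]) (auto simp: add_divide_distrib[symmetric])
    then show "inverse (s + t) *\<^sub>R (a + b) \<in> V"
      using s t by (simp add: scaleR_add_right divide_inverse_commute mult.assoc)
  qed (use s t in auto)
  have "gauge_fun V (a + b) - s \<le> gauge_fun V b" if "0 < s" "inverse s *\<^sub>R a \<in> V" for s
    unfolding gauge_fun_def[of V b] using absorb[of b] step[OF that]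
    by (intro cInf_greatest) (auto simp: algebra_simps)
  then have "gauge_fun V (a + b) - gauge_fun V b \<le> s" if "0 < s" "inverse s *\<^sub>R a \<in> V" for s
    using that by (smt (verit))
  then have "gauge_fun V (a + b) - gauge_fun V b \<le> gauge_fun V a"
    unfolding gauge_fun_def[of V a] using absorb[of a] by (intro cInf_greatest) auto
  then show "gauge_fun V (a + b) \<le> gauge_fun V a + gauge_fun V b" by simp
next
  fix c :: real and a assume c: "0 < c"
  have "gauge_fun V (c *\<^sub>R a) / c \<le> gauge_fun V a"
    unfolding gauge_fun_def[of V a]
  proof (rule cInf_greatest)
    show "{t. 0 < t \<and> inverse t *\<^sub>R a \<in> V} \<noteq> {}" using absorb[of a] by auto
    fix t assume "t \<in> {t. 0 < t \<and> inverse t *\<^sub>R a \<in> V}"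
    then have "gauge_fun V (c *\<^sub>R a) \<le> c * t"
      using c by (intro gauge_fun_le) (auto simp: field_simps)
    then show "gauge_fun V (c *\<^sub>R a) / c \<le> t" using c by (simp add: field_simps)
  qed
  then show "gauge_fun V (c *\<^sub>R a) \<le> c * gauge_fun V a" using c by (simp add: field_simps)
qed

text \<open>Hahn-Banach is applied at \<open>x\<close> to the gauge of a convex open neighbourhood
  of 0 that misses \<open>x\<close>. Domination by the gauge bounds \<open>f\<close> by 1 on that
  neighbourhood, which makes \<open>f\<close> continuous.\<close>

lemma topdual_separates:
  fixes x :: "'x::{real_vector, t2_space}"
  assumes lc: "locally_convex_tvs TYPE('x)" and x: "x \<noteq> 0"
  obtains f where "f \<in> topdual" "0 < f x"
proof -
  have cadd: "continuous_on UNIV (\<lambda>p::'x \<times> 'x. fst p + snd p)"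
    and cscale: "continuous_on UNIV (\<lambda>p::real \<times> 'x. fst p *\<^sub>R snd p)"
    using lc by (auto simp: locally_convex_tvs_def)
  \<comment> \<open>The type classes do not link topology and vector structure, so continuity of
    these maps is extracted from the joint continuity in \<open>locally_convex_tvs\<close>.\<close>
  have affine: "continuous_on UNIV (\<lambda>y::'x. c *\<^sub>R (y + a))" for c a
  proof -
    have "continuous_on UNIV (\<lambda>y. y + a)"
      using continuous_on_compose2[OF cadd, of UNIV "\<lambda>y. (y, a)"]
      by (simp add: continuous_on_Pair continuous_on_id continuous_on_const)
    then show ?thesis
      using continuous_on_compose2[OF cscale, of UNIV "\<lambda>y. (c, y + a)"]
      by (simp add: continuous_on_Pair continuous_on_const)
  qed
  have ray: "continuous_on UNIV (\<lambda>c. c *\<^sub>R y)" for y :: 'x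
    using continuous_on_compose2[OF cscale, of UNIV "\<lambda>c. (c, y)"]
    by (simp add: continuous_on_Pair continuous_on_id continuous_on_const)
  obtain U where U: "open U" "0 \<in> U" "x \<notin> U"
    using t1_space[of 0 x] x by metis
  then obtain V where V: "open V" "convex V" "0 \<in> V" "V \<subseteq> U"
    using lc unfolding locally_convex_tvs_def by blast
  have absorb: "\<exists>t>0. inverse t *\<^sub>R y \<in> V" for y
  proof -
    have "open ((\<lambda>c::real. c *\<^sub>R y) -` V)"
      using ray V(1) by (simp add: continuous_on_open_vimage)
    then obtain e where e: "e > 0" "\<And>c. dist c 0 < e \<Longrightarrow> c *\<^sub>R y \<in> V"
      using V(3) unfolding open_dist by (metis scaleR_zero_left vimage_eq)
    then show ?thesis by (intro exI[of _ "inverse (e / 2)"]) auto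
  qed
  let ?p = "gauge_fun V"
  \<comment> \<open>For \<open>t < 1\<close>, \<open>x\<close> would be a convex combination of
    \<open>inverse t *\<^sub>R x\<close> and 0, hence in \<open>V\<close>.\<close>
  have "1 \<le> ?p x"
    unfolding gauge_fun_def
  proof (rule cInf_greatest)
    fix t assume t: "t \<in> {t. 0 < t \<and> inverse t *\<^sub>R x \<in> V}"
    show "1 \<le> t"
    proof (rule ccontr)
      assume "\<not> 1 \<le> t"
      then have "t *\<^sub>R (inverse t *\<^sub>R x) + (1 - t) *\<^sub>R 0 \<in> V"
        using t V by (intro convexD[OF V(2)]) auto
      then show False using t U V by auto
    qed
  qed (use absorb in auto)
  moreover obtain f where f: "linear f" "f \<le> ?p" "f x = ?p x"
    using linear_below_sublinear_at[OF sublinear_gauge_fun[OF V(2) absorb]] by blast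
  moreover have "continuous_on UNIV f"
    unfolding continuous_on_topological
  proof (intro ballI allI impI)
    fix a B assume a: "open B" "f a \<in> B"
    obtain e where e: "e > 0" "\<And>r. dist r (f a) < e \<Longrightarrow> r \<in> B"
      using a unfolding open_dist by blast
    \<comment> \<open>On \<open>?A\<close> both multiples of \<open>y - a\<close> by
      \<open>?d\<close> and \<open>- ?d\<close> lie in \<open>V\<close>, so \<open>f y\<close> and
      \<open>f a\<close> differ by at most \<open>e / 2\<close>. Both signs are imposed because
      \<open>V\<close> need not be symmetric.\<close>
    let ?d = "2 / e"
    let ?A = "(\<lambda>y. ?d *\<^sub>R (y + - a)) -` V \<inter> (\<lambda>y. (- ?d) *\<^sub>R (y + - a)) -` V"
    have V1: "f y \<le> 1" if "y \<in> V" for y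
      using f(2) gauge_fun_le[of 1 y V] that by (auto simp: le_fun_def intro: order_trans)
    have "open ?A"
      by (intro open_Int open_vimage V(1) affine)
    moreover have "f y \<in> B" if "y \<in> ?A" for y
    proof (rule e(2))
      have "?d * (f y - f a) \<le> 1" "- ?d * (f y - f a) \<le> 1"
        using that V1[of "?d *\<^sub>R (y + - a)"] V1[of "(- ?d) *\<^sub>R (y + - a)"] 
        by (auto simp: linear_diff[OF f(1)] linear_scale[OF f(1)] linear_neg[OF f(1)])
      then have "f y - f a \<le> e / 2" "- (f y - f a) \<le> e / 2"
        using e(1) by (auto simp: field_simps)
      then show "dist (f y) (f a) < e" using e(1) by (auto simp: dist_real_def)
    qed
    ultimately show "\<exists>A. open A \<and> a \<in> A \<and> (\<forall>y\<in>UNIV. y \<in> A \<longrightarrow> f y \<in> B)"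
      using V(3) by (intro exI[of _ ?A]) auto
  qed
  ultimately show ?thesis
    using that[of f] by (auto simp: topdual_def)
qed


section \<open>Exhaustion\<close>

text \<open>A maximal disjoint family of \<open>Q\<close>-sets exists by Zorn and is countable by
  \<open>ccc\<close>. A \<open>Q\<close>-set missing its union could be added to it, so it is
  already a member and therefore disjoint from itself.\<close>

lemma exhaustion:
  assumes ccc: "\<And>F. F \<subseteq> Collect Q \<Longrightarrow> disjoint F \<Longrightarrow> countable F"
  obtains B :: "nat \<Rightarrow> 'a set" where "disjoint_family B" "\<And>n. B n = {} \<or> Q (B n)"
    "\<And>G. Q G \<Longrightarrow> G \<inter> (\<Union>n. B n) = {} \<Longrightarrow> G = {}"
proof -
  let ?D = "{F. F \<subseteq> Collect Q \<and> disjoint F}"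
  have "\<exists>F\<in>?D. \<forall>X\<in>?D. F \<subseteq> X \<longrightarrow> X = F"
  proof (rule subset_Zorn')
    fix C assume C: "subset.chain ?D C"
    have "disjoint (\<Union>C)"
    proof (rule disjointI)
      fix a b assume "a \<in> \<Union>C" "b \<in> \<Union>C" and ab: "a \<noteq> b"
      then obtain X Y where XY: "X \<in> C" "Y \<in> C" "a \<in> X" "b \<in> Y" by auto
      then have "X \<subseteq> Y \<or> Y \<subseteq> X"
        using C by (auto simp: subset_chain_def)
      then obtain Z where "Z \<in> C" "a \<in> Z" "b \<in> Z" using XY by blast
      then show "a \<inter> b = {}"
        using C ab by (auto 4 0 simp: subset_chain_def dest: disjointD)
    qed
    then show "\<Union>C \<in> ?D" using C by (auto simp: subset_chain_def)
  qed
  then obtain F where F: "F \<subseteq> Collect Q" "disjoint F"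
    and max: "\<And>X. X \<subseteq> Collect Q \<Longrightarrow> disjoint X \<Longrightarrow> F \<subseteq> X \<Longrightarrow> X = F"
    by auto
  have cF: "countable F" using F by (rule ccc)
  \<comment> \<open>Outside the range of \<open>to_nat_on F\<close>, \<open>from_nat_into\<close>
    would repeat a member of \<open>F\<close>; the default \<open>{}\<close> keeps the sequence
    disjoint by index.\<close>
  define B where "B n = (if n \<in> to_nat_on F ` F then from_nat_into F n else {})" for n
  have BF: "B (to_nat_on F a) = a" if "a \<in> F" for a
    using that cF by (simp add: B_def)
  have B: "B n = {} \<or> (B n \<in> F \<and> n = to_nat_on F (B n))" for n
    using cF by (auto simp: B_def)
  show ?thesis
  proof
    show "disjoint_family B"
      unfolding disjoint_family_on_def
      using B disjointD[OF F(2)] by (metis Int_empty_left Int_empty_right)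
    show "B n = {} \<or> Q (B n)" for n
      using B[of n] F(1) by auto
    fix G assume G: "Q G" "G \<inter> (\<Union>n. B n) = {}"
    have disj: "G \<inter> a = {}" if "a \<in> F" for a
      using G(2) BF[OF that] by blast
    then have "disjoint (insert G F)"
      using F(2) by (auto simp: disjoint_def)
    then have "G \<in> F" using max[of "insert G F"] G(1) F(1) by auto
    then show "G = {}" using disj[of G] by auto
  qed
qed

text \<open>Finite subfamilies have total measure at most that of the space, so the measures are
  summable over \<open>F\<close>, and only countably many terms of a summable family are
  nonzero.\<close>

lemma finite_measure_disjoint_countable:
  assumes "finite_measure \<mu>" "F \<subseteq> sets \<mu>" "disjoint F" "\<And>A. A \<in> F \<Longrightarrow> emeasure \<mu> A \<noteq> 0"
  shows "countable F"
proof -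
  interpret finite_measure \<mu> by fact
  have "sum (measure \<mu>) X \<le> measure \<mu> (space \<mu>)" if X: "finite X" "X \<subseteq> F" for X
  proof -
    have "sum (measure \<mu>) X = measure \<mu> (\<Union>X)"
      using finite_measure_finite_Union[of X "\<lambda>A. A"] X assms(2,3)
      by (auto simp: disjoint_family_on_def disjoint_def subset_eq)
    then show ?thesis using bounded_measure by simp
  qed
  then have "eventually (\<lambda>X. sum (measure \<mu>) X \<le> measure \<mu> (space \<mu>)) (finite_subsets_at_top F)"
    by (intro eventually_finite_subsets_at_top_weakI)
  then have "measure \<mu> summable_on F"
    by (intro nonneg_bounded_partial_sums_imp_summable_on) auto
  then have "countable {A\<in>F. measure \<mu> A \<noteq> 0}"
    by (rule summable_countable_real)
  moreover have "{A\<in>F. measure \<mu> A \<noteq> 0} = F"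
    using assms(4) by (auto simp: emeasure_eq_measure)
  ultimately show ?thesis by simp
qed

lemma finite_measure_common_null:
  fixes m :: "nat \<Rightarrow> 'w measure"
  assumes fin: "\<And>n. finite_measure (m n)" and sets: "\<And>n. sets (m n) = sets M"
  obtains \<mu> where "sets \<mu> = sets M" "finite_measure \<mu>"
    "\<And>A. A \<in> sets M \<Longrightarrow> emeasure \<mu> A = 0 \<longleftrightarrow> (\<forall>n. emeasure (m n) A = 0)"
proof -
  \<comment> \<open>The weights are positive, so no null set is gained, and each weighted total mass
    is at most \<open>(1/2) ^ Suc n\<close>. The summand 1 keeps the denominator positive for zero
    measures.\<close>
  define c where "c n = (1/2) ^ Suc n / (1 + measure (m n) (space M))" for n
  define h where "h A = (\<Sum>n. ennreal (c n) * emeasure (m n) A)" for A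
  define \<mu> where "\<mu> = measure_of (space M) (sets M) h"
  have pos: "0 < c n" for n unfolding c_def by (simp add: add_pos_nonneg)
  have sp: "space (m n) = space M" for n using sets by (rule sets_eq_imp_space_eq)
  have h: "emeasure \<mu> A = h A" if "A \<in> sets M" for A
    unfolding \<mu>_def
  proof (rule emeasure_measure_of_sigma[OF sets.sigma_algebra_axioms _ _ that])
    show "positive (sets M) h" by (simp add: positive_def h_def)
    show "countably_additive (sets M) h"
    proof (rule countably_additiveI)
      fix A :: "nat \<Rightarrow> 'w set"
      assume A: "range A \<subseteq> sets M" "disjoint_family A"
      \<comment> \<open>The double sum is interchanged by reading the sum over \<open>n\<close> as
        an integral for counting measure.\<close>
      have "(\<Sum>i. h (A i)) = (\<Sum>i. \<integral>\<^sup>+n. ennreal (c n) * emeasure (m n) (A i) \<partial>count_space UNIV)"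
        by (simp add: h_def nn_integral_count_space_nat)
      also have "\<dots> = (\<integral>\<^sup>+n. (\<Sum>i. ennreal (c n) * emeasure (m n) (A i)) \<partial>count_space UNIV)"
        by (rule nn_integral_suminf[symmetric]) simp
      also have "\<dots> = h (\<Union>i. A i)"
        using A sets by (simp add: suminf_emeasure h_def nn_integral_count_space_nat)
      finally show "(\<Sum>i. h (A i)) = h (\<Union>i. A i)" .
    qed
  qed
  show ?thesis
  proof
    show "sets \<mu> = sets M" by (simp add: \<mu>_def)
    show "emeasure \<mu> A = 0 \<longleftrightarrow> (\<forall>n. emeasure (m n) A = 0)" if "A \<in> sets M" for A
      using pos by (simp add: h[OF that] h_def suminf_eq_zero_iff ennreal_eq_0_iff linorder_not_le[THEN iffD2])
    have "h (space M) \<le> (\<Sum>n. ennreal ((1/2) ^ Suc n))"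
      unfolding h_def
    proof (intro suminf_le)
      fix n
      have "ennreal (c n) * emeasure (m n) (space M) = ennreal (c n * measure (m n) (space M))"
        using pos[of n] by (simp add: finite_measure.emeasure_eq_measure[OF fin] ennreal_mult)
      also have "\<dots> \<le> ennreal ((1/2) ^ Suc n)"
        unfolding c_def
        by (intro ennreal_leI) (simp add: pos_divide_le_eq add_pos_nonneg)
      finally show "ennreal (c n) * emeasure (m n) (space M) \<le> ennreal ((1/2) ^ Suc n)" .
    qed auto
    also have "\<dots> < \<infinity>"
      by (subst suminf_ennreal_eq[OF _ power_half_series]) auto
    finally have "emeasure \<mu> (space M) < \<infinity>" by (simp add: h)
    moreover have "space \<mu> = space M" by (simp add: \<mu>_def)
    ultimately show "finite_measure \<mu>" by (intro finite_measureI) simp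
  qed
qed

section \<open>Families of extended signed measures\<close>

lemma sigma_finite_ext_measureD:
  assumes "sigma_finite_ext_measure M g"
  shows "E \<in> sets M \<Longrightarrow> g E \<noteq> -\<infinity>" "g {} = 0"
    "\<And>A::nat \<Rightarrow> 'w set. range A \<subseteq> sets M \<Longrightarrow> disjoint_family A \<Longrightarrow> (\<lambda>n. g (A n)) sums g (\<Union>n. A n)"
  using assms unfolding sigma_finite_ext_measure_def by blast+

lemma sigma_finite_ext_measure_Un:
  assumes g: "sigma_finite_ext_measure M g" and A: "A \<in> sets M" "B \<in> sets M" "A \<inter> B = {}"
  shows "g (A \<union> B) = g A + g B"
proof -
  let ?S = "\<lambda>n::nat. if n = 0 then A else if n = 1 then B else {}"
  have "(\<lambda>n. g (?S n)) sums g (\<Union>n. ?S n)"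
    using A by (intro sigma_finite_ext_measureD(3)[OF g]) (auto simp: disjoint_family_on_def)
  moreover have "(\<Union>n. ?S n) = A \<union> B" by (auto split: if_splits)
  moreover have "(\<lambda>n. g (?S n)) sums (\<Sum>n\<in>{0,1}. g (?S n))"
    by (rule sums_finite) (auto simp: sigma_finite_ext_measureD(2)[OF g])
  ultimately show ?thesis using sums_unique2 by fastforce
qed

text \<open>As \<open>-\<infinity>\<close> is never a value, a finite sum
  \<open>g F + g (E - F)\<close> forces both summands to be finite.\<close>

lemma sigma_finite_ext_measure_finite_subset:
  assumes g: "sigma_finite_ext_measure M g" and E: "E \<in> sets M" "\<bar>g E\<bar> \<noteq> \<infinity>"
    and F: "F \<in> sets M" "F \<subseteq> E"
  shows "\<bar>g F\<bar> \<noteq> \<infinity>"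
proof -
  have "g (F \<union> (E - F)) = g F + g (E - F)"
    using E F by (intro sigma_finite_ext_measure_Un[OF g]) auto
  moreover have "F \<union> (E - F) = E" using F by auto
  moreover have "g F \<noteq> -\<infinity>" "g (E - F) \<noteq> -\<infinity>"
    using E F by (auto intro!: sigma_finite_ext_measureD(1)[OF g])
  ultimately show ?thesis using E(2) by (cases "g F"; cases "g (E - F)") auto
qed

text \<open>A signed \<open>g\<close> may vanish on \<open>E\<close> by cancellation without
  vanishing on subsets, hence the quantifier over all measurable subsets.\<close>

definition joint_null :: "'w measure \<Rightarrow> ('w set \<Rightarrow> ereal) set \<Rightarrow> 'w set set" where
  "joint_null M V = {E \<in> sets M. \<forall>F\<in>sets M. F \<subseteq> E \<longrightarrow> (\<forall>g\<in>V. g F = 0)}"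

lemma joint_null_subset:
  "E \<in> joint_null M V \<Longrightarrow> F \<in> sets M \<Longrightarrow> F \<subseteq> E \<Longrightarrow> F \<in> joint_null M V"
  by (auto simp: joint_null_def)

lemma joint_null_empty:
  assumes "\<forall>g\<in>V. sigma_finite_ext_measure M g"
  shows "{} \<in> joint_null M V"
proof -
  have "g {} = 0" if "g \<in> V" for g
    using sigma_finite_ext_measureD(2)[OF bspec[OF assms that]] .
  then show ?thesis by (auto simp: joint_null_def)
qed

lemma joint_null_UN:
  fixes B :: "nat \<Rightarrow> 'w set"
  assumes V: "\<forall>g\<in>V. sigma_finite_ext_measure M g"
    and B: "\<And>n. B n \<in> joint_null M V" "disjoint_family B"
  shows "(\<Union>n. B n) \<in> joint_null M V"
  unfolding joint_null_def
proof (intro CollectI conjI ballI impI)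
  have sB: "B n \<in> sets M" for n using B(1) by (auto simp: joint_null_def)
  then show "(\<Union>n. B n) \<in> sets M" by auto
  fix F g assume F: "F \<in> sets M" "F \<subseteq> (\<Union>n. B n)" and g: "g \<in> V"
  have "(\<lambda>n. g (F \<inter> B n)) sums g (\<Union>n. F \<inter> B n)"
    using F sB B(2) by (intro sigma_finite_ext_measureD(3)[OF bspec[OF V g]]) (auto intro: disjoint_family_subset)
  moreover have "(\<Union>n. F \<inter> B n) = F" using F by auto
  moreover have "g (F \<inter> B n) = 0" for n
    using B(1)[of n] F sB[of n] g by (auto simp: joint_null_def)
  ultimately show "g F = 0" using sums_unique2[OF _ sums_zero] by fastforce
qed

lemma joint_null_Un:
  assumes V: "\<forall>g\<in>V. sigma_finite_ext_measure M g"
    and "A \<in> joint_null M V" "B \<in> joint_null M V" "A \<inter> B = {}"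
  shows "A \<union> B \<in> joint_null M V"
  unfolding joint_null_def
proof (intro CollectI conjI ballI impI)
  show "A \<union> B \<in> sets M" using assms by (auto simp: joint_null_def)
  fix F g assume F: "F \<in> sets M" "F \<subseteq> A \<union> B" and g: "g \<in> V"
  have "g ((F \<inter> A) \<union> (F \<inter> B)) = g (F \<inter> A) + g (F \<inter> B)"
    using assms F by (intro sigma_finite_ext_measure_Un[OF bspec[OF V g]]) (auto simp: joint_null_def)
  moreover have "(F \<inter> A) \<union> (F \<inter> B) = F" using F by auto
  moreover have "g (F \<inter> A) = 0" "g (F \<inter> B) = 0"
    using assms F(1) g by (auto simp: joint_null_def)
  ultimately show "g F = 0" by simp
qed

text \<open>Common form of the three exhaustions below: by negative sets, by sets invisible to one
  \<open>g\<close>, and by dominated pieces.\<close>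

lemma exhaustion_joint_null:
  assumes ccc: "\<forall>F. F \<subseteq> sets M - joint_null M V \<longrightarrow> disjoint F \<longrightarrow> countable F"
    and Q: "\<And>G. Q G \<Longrightarrow> G \<in> sets M - joint_null M V"
  obtains B :: "nat \<Rightarrow> 'w set" where "disjoint_family B" "\<And>n. B n = {} \<or> Q (B n)" "range B \<subseteq> sets M"
    "\<And>G. Q G \<Longrightarrow> G \<inter> (\<Union>n. B n) = {} \<Longrightarrow> G = {}"
proof -
  obtain B :: "nat \<Rightarrow> 'w set" where B: "disjoint_family B" "\<And>n. B n = {} \<or> Q (B n)"
    "\<And>G. Q G \<Longrightarrow> G \<inter> (\<Union>n. B n) = {} \<Longrightarrow> G = {}"
  proof (rule exhaustion)
    fix F assume "F \<subseteq> Collect Q" "disjoint F"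
    moreover from this have "F \<subseteq> sets M - joint_null M V" using Q by blast
    ultimately show "countable F" using ccc by blast
  qed (rule that)
  have "B n \<in> sets M" for n using B(2)[of n] Q by auto
  then show ?thesis using B that by blast
qed

lemma positive_restriction_measure:
  assumes g: "sigma_finite_ext_measure M g" and S: "S \<in> sets M" "g S \<noteq> \<infinity>"
    and nonneg: "\<And>F. F \<in> sets M \<Longrightarrow> F \<subseteq> S \<Longrightarrow> 0 \<le> g F"
  obtains m where "sets m = sets M" "finite_measure m"
    "\<And>A. A \<in> sets M \<Longrightarrow> emeasure m A = 0 \<longleftrightarrow> g (A \<inter> S) = 0"
proof -
  \<comment> \<open>\<open>e2ennreal\<close> sends negative values to 0; nonnegativity of
    \<open>g\<close> on subsets of \<open>S\<close> makes the conversion lossless, so additivity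
    carries over.\<close>
  define h where "h A = e2ennreal (g (A \<inter> S))" for A
  define m where "m = measure_of (space M) (sets M) h"
  have nn: "0 \<le> g (A \<inter> S)" if "A \<in> sets M" for A
    using nonneg that S by auto
  have h: "emeasure m A = h A" if "A \<in> sets M" for A
    unfolding m_def
  proof (rule emeasure_measure_of_sigma[OF sets.sigma_algebra_axioms _ _ that])
    show "positive (sets M) h"
      by (simp add: positive_def h_def sigma_finite_ext_measureD(2)[OF g] e2ennreal_neg)
    show "countably_additive (sets M) h"
    proof (rule countably_additiveI)
      fix A :: "nat \<Rightarrow> 'a set"
      assume A: "range A \<subseteq> sets M" "disjoint_family A"
      have "(\<lambda>i. g (A i \<inter> S)) sums g (\<Union>i. A i \<inter> S)"
        using A S by (intro sigma_finite_ext_measureD(3)[OF g]) (auto simp: disjoint_family_on_def)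
      moreover have "enn2ereal (h (A i)) = g (A i \<inter> S)" for i
        using A nn[of "A i"] by (auto simp: h_def enn2ereal_e2ennreal)
      moreover have "enn2ereal (h (\<Union>i. A i)) = g (\<Union>i. A i \<inter> S)"
        using A nn[of "\<Union>i. A i"] by (auto simp: h_def enn2ereal_e2ennreal)
      ultimately have "(\<lambda>i. enn2ereal (h (A i))) sums enn2ereal (h (\<Union>i. A i))"
        by simp
      then show "(\<Sum>i. h (A i)) = h (\<Union>i. A i)"
        by (simp only: sums_enn2ereal sums_unique[symmetric])
    qed
  qed
  show ?thesis
  proof
    show "sets m = sets M" by (simp add: m_def)
    show "emeasure m A = 0 \<longleftrightarrow> g (A \<inter> S) = 0" if "A \<in> sets M" for A
      using nn[OF that] by (metis h[OF that] h_def e2ennreal_neg enn2ereal_e2ennreal order_refl zero_ennreal.rep_eq)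
    have "h (space M) \<noteq> \<infinity>"
      using S nn[of "space M"] unfolding h_def
      by (cases "g (space M \<inter> S)") (auto simp: sets.Int_space_eq1)
    moreover have "space m = space M" by (simp add: m_def)
    ultimately show "finite_measure m"
      by (intro finite_measureI) (simp add: h)
  qed
qed

section \<open>Pieces on which one finite measure detects joint nullity\<close>

lemma sums_nonpos:
  fixes f :: "nat \<Rightarrow> ereal"
  assumes "f sums l" "\<And>n. f n \<le> 0"
  shows "l \<le> 0"
proof (rule LIMSEQ_le_const2)
  show "(\<lambda>n. sum f {..<n}) \<longlonglongrightarrow> l" using assms(1) by (simp add: sums_def)
  show "\<exists>N. \<forall>n\<ge>N. sum f {..<n} \<le> 0" using assms(2) by (auto intro: sum_nonpos)
qed

text \<open>The first exhaustion plays the role of the Hahn decomposition.\<close>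

lemma dominating_piece:
  assumes V: "\<forall>g\<in>V. sigma_finite_ext_measure M g"
    and pos: "\<forall>g\<in>V. \<forall>E\<in>sets M. g E \<noteq> 0 \<longrightarrow> (\<exists>h\<in>V. 0 < h E)"
    and ccc: "\<forall>F. F \<subseteq> sets M - joint_null M V \<longrightarrow> disjoint F \<longrightarrow> countable F"
    and E: "E \<in> sets M - joint_null M V"
  obtains S m where "S \<in> sets M - joint_null M V" "S \<subseteq> E" "sets m = sets M" "finite_measure m"
    "\<And>A. A \<in> sets M \<Longrightarrow> emeasure m A = 0 \<longleftrightarrow> A \<inter> S \<in> joint_null M V"
proof -
  \<comment> \<open>A nonzero value may be negative; \<open>pos\<close> then provides another member
    of \<open>V\<close> that is positive on the same set.\<close>
  obtain g F where g: "g \<in> V" and F: "F \<in> sets M" "F \<subseteq> E" "0 < g F"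
    using E pos unfolding joint_null_def by blast
  note gm = bspec[OF V g]
  note g0 = sigma_finite_ext_measureD(2)[OF gm]
  obtain A :: "nat \<Rightarrow> 'a set" where A: "range A \<subseteq> sets M" "(\<Union>n. A n) = space M" "\<And>n. \<bar>g (A n)\<bar> \<noteq> \<infinity>"
    using gm unfolding sigma_finite_ext_measure_def by blast
  \<comment> \<open>A disjointed cover by sets of finite \<open>g\<close>-value splits
    \<open>F\<close>. As \<open>g F\<close> is positive, some piece has positive value, which is
    finite because the piece lies in \<open>A n\<close>.\<close>
  let ?D = "\<lambda>n. F \<inter> disjointed A n"
  have D: "?D n \<in> sets M" for n
    using sets.range_disjointed_sets[OF A(1)] F by auto
  have "(\<Union>n. ?D n) = F"
    using A(2) sets.sets_into_space[OF F(1)] UN_disjointed_eq[of A] by auto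
  moreover have "disjoint_family ?D"
    by (rule disjoint_family_subset[OF disjoint_family_disjointed]) auto
  ultimately have "(\<lambda>n. g (?D n)) sums g F"
    using sigma_finite_ext_measureD(3)[OF gm, of ?D] D by auto
  then obtain n where "0 < g (?D n)"
    using sums_nonpos F(3) by (metis not_less)
  moreover have "\<bar>g (?D n)\<bar> \<noteq> \<infinity>"
    using A D disjointed_subset[of A n]
    by (intro sigma_finite_ext_measure_finite_subset[OF gm _ A(3)[of n]]) auto
  ultimately obtain H where H: "H \<in> sets M" "H \<subseteq> E" "0 < g H" "\<bar>g H\<bar> \<noteq> \<infinity>"
    using D F(2) by (metis inf.coboundedI1)
  have notnull: "G \<in> sets M - joint_null M V" if "G \<in> sets M" "g G \<noteq> 0" for G
    using that g by (auto simp: joint_null_def)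

  let ?N = "\<lambda>G. G \<in> sets M \<and> G \<subseteq> H \<and> g G < 0"
  have N: "G \<in> sets M - joint_null M V" if "?N G" for G
    using that notnull[of G] by (metis less_irrefl)
  obtain B :: "nat \<Rightarrow> 'a set" where B: "disjoint_family B" "\<And>n. B n = {} \<or> ?N (B n)"
    "range B \<subseteq> sets M" "\<And>G. ?N G \<Longrightarrow> G \<inter> (\<Union>n. B n) = {} \<Longrightarrow> G = {}"
    by (rule exhaustion_joint_null[OF ccc, where Q = ?N], rule N, assumption, rule that)
  define P where "P = H - (\<Union>n. B n)"
  have UB: "(\<Union>n. B n) \<in> sets M" "(\<Union>n. B n) \<subseteq> H" using B(2,3) by blast+
  have P: "P \<in> sets M" "P \<subseteq> H" using H UB by (auto simp: P_def)
  have "g (B n) \<le> 0" for n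
    using B(2)[of n] g0 by auto
  then have "g (\<Union>n. B n) \<le> 0"
    using sums_nonpos[OF sigma_finite_ext_measureD(3)[OF gm B(3,1)]] by blast
  moreover have "g (P \<union> (\<Union>n. B n)) = g P + g (\<Union>n. B n)"
    using P UB by (intro sigma_finite_ext_measure_Un[OF gm]) (auto simp: P_def)
  moreover have "P \<union> (\<Union>n. B n) = H" using UB by (auto simp: P_def)
  ultimately have "0 < g P"
    using H(3) by (metis add_nonpos_nonpos not_le)
  \<comment> \<open>A negative \<open>G\<close> inside \<open>P\<close> misses every
    \<open>B n\<close>, so maximality makes it empty, against \<open>g {} = 0\<close>.\<close>
  have Pnn: "0 \<le> g G" if "G \<in> sets M" "G \<subseteq> P" for G
  proof (rule ccontr)
    assume neg: "\<not> 0 \<le> g G"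
    have "?N G" using that P(2) neg by auto
    moreover have "G \<inter> (\<Union>n. B n) = {}" using that(2) by (auto simp: P_def)
    ultimately have "G = {}" by (rule B(4))
    then show False using g0 neg by simp
  qed

  \<comment> \<open>These sets are not jointly null although \<open>g\<close> vanishes on them.
    Removing them costs no \<open>g\<close>-value, so \<open>g S = g P\<close> stays
    positive.\<close>
  let ?Z = "\<lambda>G. G \<in> sets M - joint_null M V \<and> G \<subseteq> P \<and> g G = 0"
  obtain C :: "nat \<Rightarrow> 'a set" where C: "disjoint_family C" "\<And>n. C n = {} \<or> ?Z (C n)"
    "range C \<subseteq> sets M" "\<And>G. ?Z G \<Longrightarrow> G \<inter> (\<Union>n. C n) = {} \<Longrightarrow> G = {}"
    by (rule exhaustion_joint_null[OF ccc, where Q = ?Z]) (blast, rule that)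
  define S where "S = P - (\<Union>n. C n)"
  have UC: "(\<Union>n. C n) \<in> sets M" "(\<Union>n. C n) \<subseteq> P" using C(2,3) by blast+
  have S: "S \<in> sets M" "S \<subseteq> P" using P UC by (auto simp: S_def)
  have "g (C n) = 0" for n
    using C(2)[of n] g0 by auto
  then have "(\<lambda>n. 0) sums g (\<Union>n. C n)"
    using sigma_finite_ext_measureD(3)[OF gm C(3,1)] by simp
  then have "g (\<Union>n. C n) = 0"
    by (rule sums_unique2[OF _ sums_zero])
  moreover have "g (S \<union> (\<Union>n. C n)) = g S + g (\<Union>n. C n)"
    using S UC by (intro sigma_finite_ext_measure_Un[OF gm]) (auto simp: S_def)
  moreover have "S \<union> (\<Union>n. C n) = P" using UC by (auto simp: S_def)
  ultimately have gS: "0 < g S" using \<open>0 < g P\<close> by simp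
  have "\<bar>g S\<bar> \<noteq> \<infinity>"
    using S P by (intro sigma_finite_ext_measure_finite_subset[OF gm H(1,4)]) auto
  then have fin: "g S \<noteq> \<infinity>" by auto
  have nonneg: "0 \<le> g F" if "F \<in> sets M" "F \<subseteq> S" for F
    using Pnn that S(2) by (meson order_trans)
  obtain m where m: "sets m = sets M" "finite_measure m"
    "\<And>A. A \<in> sets M \<Longrightarrow> emeasure m A = 0 \<longleftrightarrow> g (A \<inter> S) = 0"
    by (rule positive_restriction_measure[OF gm S(1) fin], rule nonneg, assumption+, rule that)
  show ?thesis
  proof
    show "S \<in> sets M - joint_null M V" using notnull[OF S(1)] gS by auto
    show "S \<subseteq> E" using S P H by auto
    fix A assume A: "A \<in> sets M"
    have "A \<inter> S \<in> joint_null M V" if "g (A \<inter> S) = 0"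
    proof (rule ccontr)
      assume nn: "A \<inter> S \<notin> joint_null M V"
      then have "?Z (A \<inter> S)" using that A S by auto
      moreover have "A \<inter> S \<inter> (\<Union>n. C n) = {}" by (auto simp: S_def)
      ultimately have "A \<inter> S = {}" by (rule C(4))
      then show False using nn joint_null_empty[OF V] by auto
    qed
    moreover have "g (A \<inter> S) = 0" if "A \<inter> S \<in> joint_null M V"
      using that g by (auto simp: joint_null_def)
    ultimately show "emeasure m A = 0 \<longleftrightarrow> A \<inter> S \<in> joint_null M V"
      using m(3)[OF A] by blast
  qed (fact m)+
qed

text \<open>Exhaustion by dominated pieces reduces joint nullity of \<open>E\<close> to that of all
  \<open>E \<inter> B n\<close>, and the weighted sum of the measures \<open>m n\<close> tests these
  simultaneously.\<close>

lemma equivalent_finite_measure: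
  assumes V: "\<forall>g\<in>V. sigma_finite_ext_measure M g"
    and pos: "\<forall>g\<in>V. \<forall>E\<in>sets M. g E \<noteq> 0 \<longrightarrow> (\<exists>h\<in>V. 0 < h E)"
    and ccc: "\<forall>F. F \<subseteq> sets M - joint_null M V \<longrightarrow> disjoint F \<longrightarrow> countable F"
  obtains \<mu> where "sets \<mu> = sets M" "finite_measure \<mu>"
    "\<And>E. E \<in> sets M \<Longrightarrow> emeasure \<mu> E = 0 \<longleftrightarrow> E \<in> joint_null M V"
proof -
  define dom where "dom S m \<longleftrightarrow> sets m = sets M \<and> finite_measure m \<and>
    (\<forall>A\<in>sets M. emeasure m A = 0 \<longleftrightarrow> A \<inter> S \<in> joint_null M V)" for S and m :: "'a measure"
  let ?Q = "\<lambda>S. S \<in> sets M - joint_null M V \<and> (\<exists>m. dom S m)"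
  note empty = joint_null_empty[OF V]
  obtain B :: "nat \<Rightarrow> 'a set" where B: "disjoint_family B" "\<And>n. B n = {} \<or> ?Q (B n)" "range B \<subseteq> sets M"
    "\<And>G. ?Q G \<Longrightarrow> G \<inter> (\<Union>n. B n) = {} \<Longrightarrow> G = {}"
    using exhaustion_joint_null[OF ccc, where Q = ?Q] by blast
  \<comment> \<open>Provides a measure for the indices at which the sequence is padded with
    \<open>{}\<close>.\<close>
  have "dom {} (null_measure M)"
    using empty by (auto simp: dom_def intro!: finite_measureI)
  then have "\<exists>m. dom (B n) m" for n using B(2)[of n] by auto
  then obtain m where m: "\<And>n. dom (B n) (m n)" by metis
  then obtain \<mu> where \<mu>: "sets \<mu> = sets M" "finite_measure \<mu>"
    "\<And>A. A \<in> sets M \<Longrightarrow> emeasure \<mu> A = 0 \<longleftrightarrow> (\<forall>n. emeasure (m n) A = 0)"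
    using finite_measure_common_null[of m M] unfolding dom_def by blast
  have "E \<in> joint_null M V" if E: "E \<in> sets M" and null: "\<And>n. E \<inter> B n \<in> joint_null M V" for E
  proof -
    have U: "(\<Union>n. B n) \<in> sets M" using B(3) by blast
    have "(\<Union>n. E \<inter> B n) \<in> joint_null M V"
      using B(1) null V by (intro joint_null_UN) (auto intro: disjoint_family_subset)
    moreover have "E - (\<Union>n. B n) \<in> joint_null M V"
    \<comment> \<open>Otherwise \<open>dominating_piece\<close> yields a dominated set that misses
      every \<open>B n\<close>; maximality makes it empty, yet \<open>{}\<close> is jointly
      null.\<close>
    proof (rule ccontr)
      assume "E - (\<Union>n. B n) \<notin> joint_null M V"
      then have "E - (\<Union>n. B n) \<in> sets M - joint_null M V" using E U by auto
      from dominating_piece[OF V pos ccc this]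
      obtain S m where "S \<in> sets M - joint_null M V" "S \<subseteq> E - (\<Union>n. B n)" "dom S m"
        unfolding dom_def by metis
      moreover from this have "S = {}" using B(4)[of S] by blast
      ultimately show False using empty by auto
    qed
    ultimately have "(\<Union>n. E \<inter> B n) \<union> (E - (\<Union>n. B n)) \<in> joint_null M V"
      using V by (intro joint_null_Un) auto
    moreover have "(\<Union>n. E \<inter> B n) \<union> (E - (\<Union>n. B n)) = E" by auto
    ultimately show ?thesis by simp
  qed
  moreover have "E \<inter> B n \<in> joint_null M V" if "E \<in> joint_null M V" for E n
    using that B(3) by (intro joint_null_subset[OF that]) (auto simp: joint_null_def)
  ultimately have "emeasure \<mu> E = 0 \<longleftrightarrow> E \<in> joint_null M V" if "E \<in> sets M" for E
    using \<mu>(3)[OF that] m that unfolding dom_def by blast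
  then show ?thesis using \<mu> that by blast
qed

section \<open>Control measures of multimeasures\<close>

text \<open>Separating a nonzero point of \<open>C\<close> from 0 gives a positive support value,
  not merely a nonzero one; this is the source of the hypothesis \<open>pos\<close> above.\<close>

lemma supp_fun_pos:
  fixes C :: "'x::{real_vector, t2_space} set"
  assumes lc: "locally_convex_tvs TYPE('x)" and C: "C \<noteq> {}" "C \<noteq> {0}"
  obtains f where "f \<in> topdual" "0 < supp_fun f C"
proof -
  obtain x where x: "x \<in> C" "x \<noteq> 0" using C by blast
  obtain f where f: "f \<in> topdual" "0 < f x"
    using topdual_separates[OF lc x(2)] .
  have "ereal (f x) \<le> supp_fun f C"
    unfolding supp_fun_def using x(1) by (rule SUP_upper)
  then show ?thesis using f that by (metis ereal_less(2) less_le_trans)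
qed

lemma supp_fun_singleton_0: "f \<in> topdual \<Longrightarrow> supp_fun f {0} = 0"
  using linear_0[of f] by (simp add: supp_fun_def topdual_def zero_ereal_def)

text \<open>All support functions vanish at \<open>{}\<close>, whereas a non-empty set other than
  \<open>{0}\<close> has a positive one.\<close>

lemma multimeasure_empty:
  fixes N :: "'w set \<Rightarrow> 'x::{real_vector, t2_space} set"
  assumes lc: "locally_convex_tvs TYPE('x)" and N: "multimeasure M N"
  shows "N {} = {0}"
proof (rule ccontr)
  assume "N {} \<noteq> {0}"
  moreover have "N {} \<noteq> {}" using N by (auto simp: multimeasure_def cX_def)
  ultimately obtain f where "f \<in> topdual" "0 < supp_fun f (N {})"
    using supp_fun_pos[OF lc] by metis
  then show False using N by (auto simp: multimeasure_def sigma_finite_ext_measure_def)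
qed

lemma control_measure_imp_ccc:
  assumes "control_measure M N \<mu>"
  shows "ccc_mm M N"
  unfolding ccc_mm_def
proof (intro allI impI)
  fix F assume "F \<subseteq> sets M - null_sets_mm M N" "disjoint F"
  then show "countable F"
    using assms by (intro finite_measure_disjoint_countable[of \<mu>])
      (auto simp: control_measure_def null_sets_mm_def)
qed

text \<open>\<open>ccc_mm\<close> speaks of sets with \<open>N E \<noteq> {0}\<close>, the
  exhaustion of sets that contain one. Chosen witnesses are disjoint and, by \<open>N0\<close>,
  non-empty, so the choice is injective and countability transfers.\<close>

lemma ccc_mm_hereditary:
  fixes N :: "'w set \<Rightarrow> 'x::real_vector set"
  assumes ccc: "ccc_mm M N" and N0: "N {} = {0}"
    and F: "disjoint F" "\<And>E. E \<in> F \<Longrightarrow> \<exists>G\<in>sets M. G \<subseteq> E \<and> N G \<noteq> {0}"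
  shows "countable F"
proof -
  obtain G where G: "\<And>E. E \<in> F \<Longrightarrow> G E \<in> sets M \<and> G E \<subseteq> E \<and> N (G E) \<noteq> {0}"
    using F(2) by metis
  have ne: "G E \<noteq> {}" if "E \<in> F" for E
    using G[OF that] N0 by auto
  have disj: "G D \<inter> G E = {}" if "D \<in> F" "E \<in> F" "D \<noteq> E" for D E
    using disjointD[OF F(1) that] G that by blast
  have "inj_on G F"
    using disj ne by (metis Int_absorb inj_onI)
  moreover have "countable (G ` F)"
  proof -
    have "G ` F \<subseteq> sets M - null_sets_mm M N" using G by (auto simp: null_sets_mm_def)
    moreover have "disjoint (G ` F)" using disj by (intro disjointI) blast
    ultimately show ?thesis using ccc unfolding ccc_mm_def by blast
  qed
  ultimately show ?thesis using countable_image_inj_on by blast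
qed

lemma ccc_imp_equivalent_measure:
  fixes N :: "'w set \<Rightarrow> 'x::{real_vector, t2_space} set"
  assumes lc: "locally_convex_tvs TYPE('x)" and N: "multimeasure M N" and ccc: "ccc_mm M N"
  obtains \<mu> where "sets \<mu> = sets M" "finite_measure \<mu>"
    "\<And>E. E \<in> sets M \<Longrightarrow> emeasure \<mu> E = 0 \<longleftrightarrow> (\<forall>F\<in>sets M. F \<subseteq> E \<longrightarrow> N F = {0})"
proof -
  \<comment> \<open>The family of all support functions turns the statement about sets in
    \<open>'x\<close> into one about extended real measures.\<close>
  define V where "V = (\<lambda>f E. supp_fun f (N E)) ` (topdual :: ('x \<Rightarrow> real) set)"
  have V: "\<forall>g\<in>V. sigma_finite_ext_measure M g"
    using N by (auto simp: V_def multimeasure_def)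
  have ne: "N E \<noteq> {}" if "E \<in> sets M" for E
    using N that by (auto simp: multimeasure_def cX_def)
  have pos: "\<exists>h\<in>V. 0 < h E" if E: "E \<in> sets M" "N E \<noteq> {0}" for E
  proof -
    obtain f where "f \<in> topdual" "0 < supp_fun f (N E)"
      using supp_fun_pos[OF lc ne[OF E(1)] E(2)] .
    then show ?thesis by (auto simp: V_def)
  qed
  have zero: "g E = 0" if "g \<in> V" "N E = {0}" for g E
  proof -
    obtain f where "f \<in> topdual" "g = (\<lambda>E. supp_fun f (N E))"
      using \<open>g \<in> V\<close> unfolding V_def by (rule imageE)
    then show ?thesis using \<open>N E = {0}\<close> by (simp only: supp_fun_singleton_0)
  qed
  have null: "(\<forall>g\<in>V. g E = 0) \<longleftrightarrow> N E = {0}" if "E \<in> sets M" for E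
  proof
    assume "\<forall>g\<in>V. g E = 0"
    then show "N E = {0}" using pos[OF that] by (metis less_irrefl)
  qed (simp add: zero)
  then have J: "joint_null M V = {E\<in>sets M. \<forall>F\<in>sets M. F \<subseteq> E \<longrightarrow> N F = {0}}"
    by (simp only: joint_null_def cong: ball_cong)
  have "\<forall>F. F \<subseteq> sets M - joint_null M V \<longrightarrow> disjoint F \<longrightarrow> countable F"
    by (intro allI impI ccc_mm_hereditary[OF ccc multimeasure_empty[OF lc N]]) (auto simp: J)
  moreover have "\<forall>g\<in>V. \<forall>E\<in>sets M. g E \<noteq> 0 \<longrightarrow> (\<exists>h\<in>V. 0 < h E)"
    using zero pos by metis
  ultimately obtain \<mu> where "sets \<mu> = sets M" "finite_measure \<mu>"
    "\<And>E. E \<in> sets M \<Longrightarrow> emeasure \<mu> E = 0 \<longleftrightarrow> E \<in> joint_null M V"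
    using equivalent_finite_measure[OF V] by metis
  then show ?thesis using that by (simp add: J)
qed

theorem theorem3p4:
  fixes M :: "'w measure" and N :: "'w set \<Rightarrow> 'x::{real_vector, t2_space} set"
  assumes "locally_convex_tvs TYPE('x)"
    and "multimeasure M N"
  shows "((\<exists>\<mu>. control_measure M N \<mu>) \<longleftrightarrow> ccc_mm M N) \<and>
         (ccc_mm M N \<longrightarrow>
            (\<exists>\<mu>. control_measure M N \<mu> \<and>
                 (\<forall>E\<in>sets M. emeasure \<mu> E = 0 \<longleftrightarrow>
                    (\<forall>F\<in>sets M. F \<subseteq> E \<longrightarrow> N F = {0}))))"
proof -
  have "\<exists>\<mu>. control_measure M N \<mu> \<and>
      (\<forall>E\<in>sets M. emeasure \<mu> E = 0 \<longleftrightarrow> (\<forall>F\<in>sets M. F \<subseteq> E \<longrightarrow> N F = {0}))"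
    if ccc: "ccc_mm M N"
  proof -
    obtain \<mu> where \<mu>: "sets \<mu> = sets M" "finite_measure \<mu>"
      "\<And>E. E \<in> sets M \<Longrightarrow> emeasure \<mu> E = 0 \<longleftrightarrow> (\<forall>F\<in>sets M. F \<subseteq> E \<longrightarrow> N F = {0})"
      by (rule ccc_imp_equivalent_measure[OF assms ccc]) (rule that)
    \<comment> \<open>The case \<open>F = E\<close> of the equivalence gives
      \<open>N E = {0}\<close> on null sets.\<close>
    then have "control_measure M N \<mu>"
      using sets_eq_imp_space_eq[OF \<mu>(1)] by (auto simp: control_measure_def)
    with \<mu>(3) show ?thesis by (intro exI conjI ballI)
  qed
  then show ?thesis using control_measure_imp_ccc[of M N] by metis
qed

end
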